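(* For all integers $m\ge 1$ and $n\ge 1$, the density $D(K_m\times P_n)$ of connected sets of $K_m\times P_n$ satisfies $$D(K_m\times P_n)=\frac{\sum_{k=1}^{n}(n-k+1)\Big\{mk\,f(m,k)-\sum_{i=1}^{m-1}\sum_{s=1}^{k}\binom{m}{i}(m-i)\,f_i(m,s)\,f_i(m,k+1-s)\Big\}}{mn\sum_{k=1}^{n}(n-k+1)f(m,k)}.$$
   Context: $K_m$ is the complete graph on $m$ vertices and $P_n$ the path on $n$ vertices. $K_m\times P_n$ denotes their Cartesian product: the vertices are $v_{k,j}$ with $1\le k\le n$, $1\le j\le m$, and $v_{k,j}$, $v_{k',j'}$ are adjacent iff either $k=k'$ and $j\ne j'$, or $j=j'$ and $|k-k'|=1$. The set $\{v_{k,1},\dots,v_{k,m}\}$ is called the $k$-th layer. A connected set of a graph $G$ is a nonempty vertex subset $M$ whose induced subgraph is connected. $N(G)$ is the number of connected sets of $G$, $S(G)$ is the sum of the orders $|M|$ over all connected sets $M$ of $G$, $A(G)=S(G)/N(G)$, and the density is $D(G)=A(G)/|V(G)|$. For $k\ge1$, $f(m,k)$ is the number of connected sets of $K_m\times P_k$ that contain at least one vertex of every one of the $k$ layers. For $1\le i\le m$ and $k\ge 1$, $f_i(m,k)$ is the number of connected sets of $K_m\times P_k$ that contain at least one vertex of each of the first $k-1$ layers and whose intersection with the $k$-th layer is exactly a given fixed set of $i$ vertices (this number does not depend on which $i$ vertices are fixed). *)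

theory Defs
  imports Complex_Main "Graph_Theory.Graph_Theory"
begin

section \<open>Connected sets and their density\<close>

text \<open>Graphs are symmetric digraphs.  The constant \<open>connected\<close> is qualified below because
  \<open>Complex_Main\<close> has a topological notion of the same name.\<close>

definition connected_sets :: "('a, 'b) pre_digraph \<Rightarrow> 'a set set" where
  "connected_sets G = {M. M \<subseteq> verts G \<and> M \<noteq> {} \<and> Digraph_Component.connected (G \<restriction> M)}"

definition num_connected_sets :: "('a, 'b) pre_digraph \<Rightarrow> nat" where
  "num_connected_sets G = card (connected_sets G)"

definition total_order_connected_sets :: "('a, 'b) pre_digraph \<Rightarrow> nat" where
  "total_order_connected_sets G = (\<Sum>M\<in>connected_sets G. card M)"

definition avg_connected_set :: "('a, 'b) pre_digraph \<Rightarrow> real" where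
  "avg_connected_set G = real (total_order_connected_sets G) / real (num_connected_sets G)"

definition connected_set_density :: "('a, 'b) pre_digraph \<Rightarrow> real" where
  "connected_set_density G = avg_connected_set G / real (card (verts G))"


section \<open>The graph \<open>K\<^sub>m \<times> P\<^sub>n\<close>\<close>

text \<open>The pair \<open>(k, j)\<close> is the vertex \<open>v\<^sub>k\<^sub>,\<^sub>j\<close>, that is, \<open>k\<close> is the layer.\<close>

definition KP :: "nat \<Rightarrow> nat \<Rightarrow> (nat \<times> nat) pair_pre_digraph" where
  "KP m n = \<lparr> pverts = {1..n} \<times> {1..m},
     parcs = {((k, j), (k', j')).
        k \<in> {1..n} \<and> k' \<in> {1..n} \<and> j \<in> {1..m} \<and> j' \<in> {1..m} \<and>
        (k = k' \<and> j \<noteq> j' \<or> j = j' \<and> \<bar>int k - int k'\<bar> = 1)} \<rparr>"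

definition layer :: "nat \<Rightarrow> nat \<Rightarrow> (nat \<times> nat) set" where
  "layer m k = {k} \<times> {1..m}"

definition num_spanning_layers :: "nat \<Rightarrow> nat \<Rightarrow> nat" where
  "num_spanning_layers m k =
     card {M \<in> connected_sets (KP m k). \<forall>l\<in>{1..k}. M \<inter> layer m l \<noteq> {}}"

definition num_prescribed_end :: "nat \<Rightarrow> nat \<Rightarrow> nat set \<Rightarrow> nat" where
  "num_prescribed_end m k J =
     card {M \<in> connected_sets (KP m k).
             (\<forall>l\<in>{1..<k}. M \<inter> layer m l \<noteq> {}) \<and> M \<inter> layer m k = {k} \<times> J}"

text \<open>The number \<open>f\<^sub>i(m, k)\<close>, with \<open>v\<^sub>k\<^sub>,\<^sub>1, \<dots>, v\<^sub>k\<^sub>,\<^sub>i\<close> as the fixed set of \<open>i\<close> vertices;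
  see \<open>num_fixed_end_eq\<close> for the independence of this choice.\<close>

definition num_fixed_end :: "nat \<Rightarrow> nat \<Rightarrow> nat \<Rightarrow> nat" where
  "num_fixed_end i m k = num_prescribed_end m k {1..i}"


section \<open>Basic facts\<close>

lemma graph_KP: "graph (with_proj (KP m n))"
proof -
  let ?G = "with_proj (KP m n)"
  have verts: "tail ?G e \<in> verts ?G" "head ?G e \<in> verts ?G" if "e \<in> arcs ?G" for e
    using that by (auto simp: KP_def)
  have loop: "tail ?G e \<noteq> head ?G e" if "e \<in> arcs ?G" for e
    using that by (auto simp: KP_def)
  have "arcs ?G \<subseteq> verts ?G \<times> verts ?G"
    using verts by (simp add: subset_iff mem_Times_iff)
  then have "finite (arcs ?G)"
    by (rule finite_subset) (simp add: KP_def)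
  moreover have "(v, u) \<in> parcs (KP m n)" if "(u, v) \<in> parcs (KP m n)" for u v
    using that by (auto simp: KP_def)
  then have "symmetric ?G"
    by (simp add: symmetric_def arcs_ends_def arc_to_ends_def sym_def)
  ultimately show ?thesis
    using verts loop by unfold_locales (simp_all add: KP_def arc_to_ends_def)
qed

lemma card_verts_KP: "card (verts (with_proj (KP m n))) = m * n"
  by (simp add: KP_def card_cartesian_product)

lemma connected_sets_image:
  assumes M: "M \<in> connected_sets (KP m k)" and p: "bij_betw p {1..m} {1..m}"
  shows "map_prod id p ` M \<in> connected_sets (KP m k)"
proof -
  let ?\<phi> = "map_prod id p"
  let ?G = "with_proj (KP m k)"
  from M have sub: "M \<subseteq> {1..k} \<times> {1..m}" and ne: "M \<noteq> {}"
    and con: "Digraph_Component.connected (?G \<restriction> M)"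
    by (auto simp: connected_sets_def KP_def)
  have pm: "p x \<in> {1..m}" if "x \<in> {1..m}" for x
    using bij_betwE[OF p] that by blast
  have pi: "p x = p y \<longleftrightarrow> x = y" if "x \<in> {1..m}" "y \<in> {1..m}" for x y
    using inj_on_eq_iff[OF bij_betw_imp_inj_on[OF p] that] .
  have ends: "arcs_ends (?G \<restriction> X) = {(u, v). (u, v) \<in> parcs (KP m k) \<and> u \<in> X \<and> v \<in> X}" for X
    by (auto simp: arcs_ends_def arc_to_ends_def induce_subgraph_def)
  have arc: "(?\<phi> u, ?\<phi> v) \<in> parcs (KP m k)" if "(u, v) \<in> parcs (KP m k)" for u v
  proof -
    obtain a b c d where uv: "u = (a, b)" "v = (c, d)" by (metis surj_pair)
    with that have "b \<in> {1..m}" "d \<in> {1..m}" by (simp_all add: KP_def)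
    with that uv pm[of b] pm[of d] pi[of b d] show ?thesis by (auto simp: KP_def)
  qed
  have edge: "(?\<phi> u, ?\<phi> v) \<in> (arcs_ends (?G \<restriction> (?\<phi> ` M)))\<^sup>s"
    if "(u, v) \<in> (arcs_ends (?G \<restriction> M))\<^sup>s" for u v
  proof -
    from that consider "(u, v) \<in> arcs_ends (?G \<restriction> M)" | "(v, u) \<in> arcs_ends (?G \<restriction> M)"
      by (auto simp: symcl_def)
    then show ?thesis
    proof cases
      case 1
      then have "(?\<phi> u, ?\<phi> v) \<in> arcs_ends (?G \<restriction> (?\<phi> ` M))"
        using arc by (simp add: ends)
      then show ?thesis by (simp add: symcl_def)
    next
      case 2
      then have "(?\<phi> v, ?\<phi> u) \<in> arcs_ends (?G \<restriction> (?\<phi> ` M))"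
        using arc by (simp add: ends)
      then show ?thesis by (force simp: symcl_def)
    qed
  qed
  have reach: "(?\<phi> u, ?\<phi> v) \<in> rtrancl_on (?\<phi> ` M) ((arcs_ends (?G \<restriction> (?\<phi> ` M)))\<^sup>s)"
    if "(u, v) \<in> rtrancl_on M ((arcs_ends (?G \<restriction> M))\<^sup>s)" for u v
    using that
  proof (induction rule: rtrancl_on_induct)
    case base
    then show ?case by auto
  next
    case (step v w)
    then show ?case
      using edge[of v w] by (meson imageI rtrancl_on_into_rtrancl_on)
  qed
  have "Digraph_Component.connected (?G \<restriction> (?\<phi> ` M))"
    using con reach ne by (auto simp: connected_conv)
  moreover have "?\<phi> ` M \<subseteq> {1..k} \<times> {1..m}"
    using sub pm by fastforce
  ultimately show ?thesis
    using ne by (auto simp: connected_sets_def KP_def)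
qed

lemma finite_connected_sets_KP: "finite (connected_sets (KP m k))"
  by (rule finite_subset[of _ "Pow ({1..k} \<times> {1..m})"]) (auto simp: connected_sets_def KP_def)

lemma num_prescribed_end_le:
  assumes J: "J \<subseteq> {1..m}" and J': "J' \<subseteq> {1..m}" and c: "card J = card J'"
  shows "num_prescribed_end m k J \<le> num_prescribed_end m k J'"
proof -
  have fin: "finite J" "finite J'"
    using J J' finite_subset by auto
  obtain g where g: "bij_betw g J J'"
    using finite_same_card_bij[OF fin c] by blast
  have "card ({1..m} - J) = card ({1..m} - J')"
    using J J' c fin by (simp add: card_Diff_subset)
  then obtain h where h: "bij_betw h ({1..m} - J) ({1..m} - J')"
    using finite_same_card_bij[of "{1..m} - J" "{1..m} - J'"] by auto
  define p where "p x = (if x \<in> J then g x else h x)" for x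
  have pJ: "bij_betw p J J'"
    using g by (simp add: p_def cong: bij_betw_cong)
  have pJc: "bij_betw p ({1..m} - J) ({1..m} - J')"
    using h bij_betw_cong[of "{1..m} - J" p h] by (simp add: p_def)
  have p: "bij_betw p {1..m} {1..m}"
    using bij_betw_combine[OF pJ pJc] J J' by (simp add: Un_absorb1)
  let ?\<phi> = "map_prod (id :: nat \<Rightarrow> nat) p"
  let ?S = "\<lambda>J. {M \<in> connected_sets (KP m k).
             (\<forall>l\<in>{1..<k}. M \<inter> layer m l \<noteq> {}) \<and> M \<inter> layer m k = {k} \<times> J}"
  have inj: "inj_on ?\<phi> (UNIV \<times> {1..m})"
    unfolding inj_on_def using inj_on_eq_iff[OF bij_betw_imp_inj_on[OF p]]
    by (simp add: map_prod_def mem_Times_iff prod_eq_iff split_beta)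
  have sub: "M \<subseteq> UNIV \<times> {1..m}" if "M \<in> ?S J" for M
    using that by (auto simp: connected_sets_def KP_def)
  have img: "f ` A \<inter> B = f ` {y \<in> A. f y \<in> B}" for f :: "nat \<times> nat \<Rightarrow> nat \<times> nat" and A B
    by blast
  have lay: "?\<phi> ` M \<inter> layer m l = ?\<phi> ` (M \<inter> layer m l)" if "M \<in> ?S J" for M l
  proof -
    have "p x \<in> {1..m}" if "x \<in> {1..m}" for x
      using bij_betwE[OF p] that by blast
    then have mem: "?\<phi> y \<in> layer m l \<longleftrightarrow> y \<in> layer m l" if "y \<in> M" for y
      using subsetD[OF sub[OF \<open>M \<in> ?S J\<close>] that] by (cases y) (simp add: layer_def)
    have "?\<phi> ` M \<inter> layer m l = ?\<phi> ` {y \<in> M. ?\<phi> y \<in> layer m l}"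
      by (rule img)
    also have "{y \<in> M. ?\<phi> y \<in> layer m l} = M \<inter> layer m l"
      unfolding Int_def by (rule Collect_cong) (use mem in meson)
    finally show ?thesis .
  qed
  have end': "?\<phi> ` ({k} \<times> J) = {k} \<times> J'"
    by (rule map_prod_surj_on) (simp_all add: bij_betw_imp_surj_on[OF pJ])
  have "inj_on ((`) ?\<phi>) (?S J)"
  proof (rule inj_onI)
    fix A B assume "A \<in> ?S J" "B \<in> ?S J" "?\<phi> ` A = ?\<phi> ` B"
    then show "A = B"
      using inj_on_image_eq_iff[OF inj sub sub] by blast
  qed
  moreover have "(`) ?\<phi> ` ?S J \<subseteq> ?S J'"
  proof
    fix N assume "N \<in> (`) ?\<phi> ` ?S J"
    then obtain M where M: "M \<in> ?S J" and N: "N = ?\<phi> ` M" by blast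
    have "N \<in> connected_sets (KP m k)"
      using M N connected_sets_image[OF _ p] by simp
    moreover have "N \<inter> layer m k = {k} \<times> J'"
      unfolding N lay[OF M] using M end' by simp
    moreover have "N \<inter> layer m l \<noteq> {}" if "l \<in> {1..<k}" for l
      unfolding N lay[OF M] using M that by simp
    ultimately show "N \<in> ?S J'" by simp
  qed
  moreover have "finite (?S J')"
    using finite_connected_sets_KP by simp
  ultimately show ?thesis
    unfolding num_prescribed_end_def by (rule card_inj_on_le)
qed

lemma num_fixed_end_eq:
  assumes "J \<subseteq> {1..m}" and "card J = i"
  shows "num_prescribed_end m k J = num_fixed_end i m k"
proof -
  have "i \<le> m"
    using assms card_mono[of "{1..m}" J] by simp
  then show ?thesis
    unfolding num_fixed_end_def
    using num_prescribed_end_le[of J m "{1..i}" k] num_prescribed_end_le[of "{1..i}" m J k] assms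
    by (simp add: le_antisym)
qed

end

theory Submission
  imports Defs
begin

text \<open>The layers met by a connected set are consecutive, so every connected set of
  \<open>K\<^sub>m \<times> P\<^sub>n\<close> is one of the \<open>n - k + 1\<close> translates of a connected set of \<open>K\<^sub>m \<times> P\<^sub>k\<close> that meets
  all layers.  The order of the latter is \<open>mk\<close> minus the number of missing vertices, counted layer
  by layer.  Since a layer is a clique, a set that meets layer \<open>s\<close> in the nonempty set \<open>J\<close> is
  connected iff its parts in the layers up to \<open>s\<close> and from \<open>s\<close> on are; reflecting the second
  part gives the product \<open>f\<^sub>i(m, s) f\<^sub>i(m, k + 1 - s)\<close> with \<open>i = |J|\<close>.\<close>

section \<open>Connectedness along an ambient relation\<close>

text \<open>Connectedness of \<open>M\<close> as reachability along an ambient relation \<open>E\<close>; unlike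
  \<^const>\<open>connected_sets\<close> it does not depend on the number of layers of the surrounding graph.\<close>

definition linked :: "('a \<times> 'a) set \<Rightarrow> 'a set \<Rightarrow> bool" where
  "linked E M \<longleftrightarrow> M \<noteq> {} \<and> (\<forall>u\<in>M. \<forall>v\<in>M. (u, v) \<in> (E \<inter> M \<times> M)\<^sup>*)"

lemma linked_image:
  assumes M: "linked E M"
    and g: "\<And>u v. u \<in> M \<Longrightarrow> v \<in> M \<Longrightarrow> (u, v) \<in> E \<Longrightarrow> (g u, g v) \<in> F"
  shows "linked F (g ` M)"
proof -
  have "(g u, g v) \<in> (F \<inter> g ` M \<times> g ` M)\<^sup>*" if "(u, v) \<in> (E \<inter> M \<times> M)\<^sup>*" for u v
    using that
  proof (induction rule: rtrancl_induct)
    case base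
    then show ?case by simp
  next
    case (step v w)
    then have "(g v, g w) \<in> F \<inter> g ` M \<times> g ` M"
      using g by blast
    with step.IH show ?case by (rule rtrancl_into_rtrancl)
  qed
  then show ?thesis
    using M by (auto simp: linked_def)
qed

text \<open>Any two vertices are joined by a walk through a common vertex \<open>c\<close> of the
  two sets.\<close>

lemma linked_Un:
  assumes A: "linked E A" and B: "linked E B" and AB: "A \<inter> B \<noteq> {}"
  shows "linked E (A \<union> B)"
proof -
  obtain c where c: "c \<in> A" "c \<in> B"
    using AB by blast
  let ?R = "(E \<inter> (A \<union> B) \<times> (A \<union> B))\<^sup>*"
  have "(E \<inter> A \<times> A)\<^sup>* \<subseteq> ?R" "(E \<inter> B \<times> B)\<^sup>* \<subseteq> ?R"
    by (rule rtrancl_mono; blast)+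
  then have "(u, c) \<in> ?R" "(c, u) \<in> ?R" if "u \<in> A \<union> B" for u
    using that A B c unfolding linked_def by (meson UnE subsetD)+
  then have "(u, v) \<in> ?R" if "u \<in> A \<union> B" "v \<in> A \<union> B" for u v
    using that by (meson rtrancl_trans)
  then show ?thesis
    using c by (auto simp: linked_def)
qed

text \<open>A walk that leaves \<open>A\<close> does so through the clique \<open>C\<close> and returns to it, so the excursion
  can be replaced by a single edge.\<close>

lemma linked_cut_clique:
  assumes M: "linked E M" and A: "A \<subseteq> M" and C: "C \<subseteq> A" "C \<noteq> {}" and E: "sym E"
    and clique: "\<And>u v. u \<in> C \<Longrightarrow> v \<in> C \<Longrightarrow> u \<noteq> v \<Longrightarrow> (u, v) \<in> E"
    and cut: "\<And>u v. u \<in> A \<Longrightarrow> v \<in> M - A \<Longrightarrow> (u, v) \<in> E \<Longrightarrow> u \<in> C"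
  shows "linked E A"
proof -
  let ?R = "(E \<inter> A \<times> A)\<^sup>*"
  \<comment> \<open>Inside a clique one edge, or none if the vertices coincide, suffices.\<close>
  have CC: "(u, v) \<in> ?R" if "u \<in> C" "v \<in> C" for u v
    using that clique[of u v] C by (cases "u = v") auto
  \<comment> \<open>Invariant for the walk: while it is outside \<open>A\<close>, its start already
    reaches every vertex of \<open>C\<close> within \<open>A\<close>, so it does not matter where
    the walk returns.\<close>
  have "(v \<in> A \<longrightarrow> (u, v) \<in> ?R) \<and> (v \<notin> A \<longrightarrow> (\<forall>c\<in>C. (u, c) \<in> ?R))"
    if "(u, v) \<in> (E \<inter> M \<times> M)\<^sup>*" "u \<in> A" for u v
    using that(1)
  proof (induction rule: rtrancl_induct)
    case base
    then show ?case using \<open>u \<in> A\<close> by simp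
  next
    case (step v w)
    have vw: "(v, w) \<in> E" "(w, v) \<in> E" "v \<in> M" "w \<in> M"
      using step.hyps(2) E by (auto dest: symD)
    consider "v \<in> A" "w \<in> A" | "v \<in> A" "w \<notin> A" | "v \<notin> A" "w \<in> A" | "v \<notin> A" "w \<notin> A"
      by blast
    then show ?case
    proof cases
      case 1
      then have "(v, w) \<in> E \<inter> A \<times> A" using vw by blast
      then show ?thesis using 1 step.IH by (meson rtrancl_into_rtrancl)
    next
      case 2
      then have "v \<in> C" using cut vw by blast
      then show ?thesis using 2 step.IH CC by (meson rtrancl_trans)
    next
      case 3
      \<comment> \<open>By symmetry the returning edge, read backwards, leaves \<open>A\<close>;
        hence its endpoint \<open>w\<close> lies in \<open>C\<close>.\<close>
      then have "w \<in> C" using cut vw by blast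
      then show ?thesis using 3 step.IH by blast
    next
      case 4
      then show ?thesis using step.IH by blast
    qed
  qed
  then have "(u, v) \<in> ?R" if "u \<in> A" "v \<in> A" for u v
    using that M A unfolding linked_def by blast
  then show ?thesis
    using C by (auto simp: linked_def)
qed

section \<open>The unbounded grid and its connected sets\<close>

text \<open>Adjacency of \<open>KP m n\<close> without the index bounds: one relation for all
  \<open>m\<close> and \<open>n\<close>, so that pieces of a set and its translates live in the same
  graph.\<close>

definition grid_edges :: "((nat \<times> nat) \<times> (nat \<times> nat)) set" where
  "grid_edges = {((k, j), (k', j')). k = k' \<and> j \<noteq> j' \<or> j = j' \<and> \<bar>int k - int k'\<bar> = 1}"

lemma sym_grid_edges: "sym grid_edges"
  by (auto simp: sym_def grid_edges_def)

text \<open>On \<open>M\<close> the arcs of the induced subgraph are \<open>grid_edges\<close>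
  restricted to \<open>M\<close>. This relation is symmetric, so its symmetric closure adds nothing,
  and from a start in \<open>M\<close> the closure \<open>rtrancl_on M\<close> agrees with the
  ordinary one.\<close>

lemma connected_sets_KP:
  "connected_sets (KP m n) = {M. M \<subseteq> {1..n} \<times> {1..m} \<and> linked grid_edges M}"
proof -
  have "Digraph_Component.connected (with_proj (KP m n) \<restriction> M) \<longleftrightarrow>
      (\<forall>u\<in>M. \<forall>v\<in>M. (u, v) \<in> (grid_edges \<inter> M \<times> M)\<^sup>*)"
    if M: "M \<subseteq> {1..n} \<times> {1..m}" "M \<noteq> {}" for M
  proof -
    let ?R = "grid_edges \<inter> M \<times> M"
    have "arcs_ends (with_proj (KP m n) \<restriction> M) = ?R"
      using M(1)
      by (fastforce simp: arcs_ends_def arc_to_ends_def induce_subgraph_def KP_def grid_edges_def)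
    moreover have "sym ?R"
      using sym_grid_edges by (auto simp: sym_def)
    then have "?R\<^sup>s = ?R"
      by (auto simp: symcl_def sym_def)
    moreover have "(u, v) \<in> rtrancl_on M ?R \<longleftrightarrow> (u, v) \<in> ?R\<^sup>*" if "u \<in> M" for u v
    proof
      assume "(u, v) \<in> ?R\<^sup>*"
      then show "(u, v) \<in> rtrancl_on M ?R"
        by (induction rule: rtrancl_induct) (use that in \<open>auto intro: rtrancl_on_into_rtrancl_on\<close>)
    qed (simp add: rtrancl_on_rtranclI)
    ultimately show ?thesis
      using M(2) by (simp add: connected_conv)
  qed
  then show ?thesis
    by (auto simp: connected_sets_def linked_def KP_def)
qed

text \<open>An edge changes the layer by at most one, so a walk that starts below layer
  \<open>c\<close> and avoids it stays below it.\<close>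

lemma grid_linked_layers_interval:
  assumes M: "linked grid_edges M" and a: "a \<in> fst ` M" and b: "b \<in> fst ` M"
    and c: "a \<le> c" "c \<le> b"
  shows "c \<in> fst ` M"
proof (rule ccontr)
  assume nc: "c \<notin> fst ` M"
  obtain u v where u: "u \<in> M" "fst u = a" and v: "v \<in> M" "fst v = b"
    using a b by blast
  have "(u, v) \<in> (grid_edges \<inter> M \<times> M)\<^sup>*"
    using M u v by (simp add: linked_def)
  then have "fst v < c"
  proof (induction rule: rtrancl_induct)
    case base
    show ?case using u c nc by (metis image_eqI le_neq_implies_less)
  next
    case (step v w)
    then have "fst w \<noteq> c" "fst w \<le> Suc (fst v)"
      using nc by (auto simp: grid_edges_def)
    then show ?case using step.IH by simp
  qed
  then show False using v c by simp
qed

section \<open>Connected sets meeting exactly the layers of an interval\<close>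

definition spanning_sets :: "nat \<Rightarrow> nat \<Rightarrow> nat \<Rightarrow> (nat \<times> nat) set set" where
  "spanning_sets m a b =
     {M. M \<subseteq> {a..b} \<times> {1..m} \<and> linked grid_edges M \<and> fst ` M = {a..b}}"

lemma finite_spanning_sets: "finite (spanning_sets m a b)"
  by (rule finite_subset[of _ "Pow ({a..b} \<times> {1..m})"]) (auto simp: spanning_sets_def)

lemma fst_image_eq_iff_layers:
  assumes "M \<subseteq> {a..b} \<times> {1..m}"
  shows "fst ` M = {a..b} \<longleftrightarrow> (\<forall>l\<in>{a..b}. M \<inter> layer m l \<noteq> {})"
proof -
  have "l \<in> fst ` M \<longleftrightarrow> M \<inter> layer m l \<noteq> {}" for l
    using assms by (fastforce simp: layer_def image_iff)
  moreover have "fst ` M \<subseteq> {a..b}"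
    using assms by auto
  ultimately show ?thesis by blast
qed

lemma num_spanning_layers_eq: "num_spanning_layers m k = card (spanning_sets m 1 k)"
proof -
  have "M \<in> connected_sets (KP m k) \<and> (\<forall>l\<in>{1..k}. M \<inter> layer m l \<noteq> {}) \<longleftrightarrow>
      M \<in> spanning_sets m 1 k" for M
    using fst_image_eq_iff_layers[of M 1 k m]
    unfolding spanning_sets_def connected_sets_KP mem_Collect_eq by meson
  then show ?thesis
    unfolding num_spanning_layers_def by simp
qed

text \<open>The definition of \<open>num_prescribed_end\<close> asks only for the first
  \<open>k - 1\<close> layers to be met; a nonempty \<open>J\<close> makes the last one met as
  well.\<close>

lemma num_prescribed_end_eq:
  assumes "J \<noteq> {}" "J \<subseteq> {1..m}" "k \<ge> 1"
  shows "num_prescribed_end m k J =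
    card {M \<in> spanning_sets m 1 k. M \<inter> layer m k = {k} \<times> J}"
proof -
  have k: "{1..k} = insert k {1..<k}"
    using assms(3) by auto
  have lay: "(\<forall>l\<in>{1..k}. M \<inter> layer m l \<noteq> {}) \<longleftrightarrow> (\<forall>l\<in>{1..<k}. M \<inter> layer m l \<noteq> {})"
    if "M \<inter> layer m k = {k} \<times> J" for M
    using that assms(1) unfolding k by auto
  have "M \<in> connected_sets (KP m k) \<and> (\<forall>l\<in>{1..<k}. M \<inter> layer m l \<noteq> {}) \<and>
        M \<inter> layer m k = {k} \<times> J \<longleftrightarrow>
      M \<in> spanning_sets m 1 k \<and> M \<inter> layer m k = {k} \<times> J" for M
    using fst_image_eq_iff_layers[of M 1 k m] lay[of M]
    unfolding spanning_sets_def connected_sets_KP mem_Collect_eq by meson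
  then show ?thesis
    unfolding num_prescribed_end_def by simp
qed

section \<open>Translating and reflecting the layers\<close>

text \<open>Edges within a layer stay within a layer, and edges between neighbouring layers are kept
  because \<open>h\<close> preserves distance one.\<close>

lemma spanning_sets_image:
  assumes M: "M \<in> spanning_sets m a b" and h: "h ` {a..b} = {c..d}"
    and adj: "\<And>k l. k \<in> {a..b} \<Longrightarrow> l \<in> {a..b} \<Longrightarrow> \<bar>int k - int l\<bar> = 1 \<Longrightarrow>
      \<bar>int (h k) - int (h l)\<bar> = 1"
  shows "map_prod h id ` M \<in> spanning_sets m c d"
proof -
  have sub: "M \<subseteq> {a..b} \<times> {1..m}"
    using M by (simp add: spanning_sets_def)
  have "linked grid_edges (map_prod h id ` M)"
  proof (rule linked_image)
    show "linked grid_edges M" using M by (simp add: spanning_sets_def)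
    show "(map_prod h id u, map_prod h id v) \<in> grid_edges"
      if "u \<in> M" "v \<in> M" "(u, v) \<in> grid_edges" for u v
      using that subsetD[OF sub, of u] subsetD[OF sub, of v] adj[of "fst u" "fst v"]
      by (auto simp: grid_edges_def)
  qed
  moreover have "fst ` map_prod h id ` M = h ` fst ` M"
    by (auto simp: image_image)
  moreover have "map_prod h id ` M \<subseteq> {c..d} \<times> {1..m}"
    using sub h by fastforce
  ultimately show ?thesis
    using M h by (simp add: spanning_sets_def)
qed

text \<open>Common source of the translation and the reflection: \<open>h\<close> and
  \<open>h'\<close> induce mutually inverse maps on sets.\<close>

lemma spanning_sets_bij:
  assumes h: "h ` {a..b} = {c..d}" and h': "h' ` {c..d} = {a..b}"
    and adj: "\<And>k l. k \<in> {a..b} \<Longrightarrow> l \<in> {a..b} \<Longrightarrow> \<bar>int k - int l\<bar> = 1 \<Longrightarrow>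
      \<bar>int (h k) - int (h l)\<bar> = 1"
    and adj': "\<And>k l. k \<in> {c..d} \<Longrightarrow> l \<in> {c..d} \<Longrightarrow> \<bar>int k - int l\<bar> = 1 \<Longrightarrow>
      \<bar>int (h' k) - int (h' l)\<bar> = 1"
    and inv: "\<And>k. k \<in> {a..b} \<Longrightarrow> h' (h k) = k" "\<And>k. k \<in> {c..d} \<Longrightarrow> h (h' k) = k"
  shows "bij_betw ((`) (map_prod h id)) (spanning_sets m a b) (spanning_sets m c d)"
proof (rule bij_betw_byWitness[where f' = "(`) (map_prod h' id)"])
  have "map_prod h' id ` map_prod h id ` M = M" if "M \<in> spanning_sets m a b" for M
  proof -
    have "map_prod h' id (map_prod h id u) = u" if "u \<in> M" for u
      using that \<open>M \<in> _\<close> inv(1)[of "fst u"] by (auto simp: spanning_sets_def prod_eq_iff)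
    then show ?thesis by (simp add: image_image)
  qed
  then show "\<forall>M\<in>spanning_sets m a b. map_prod h' id ` map_prod h id ` M = M" by blast
  have "map_prod h id ` map_prod h' id ` M = M" if "M \<in> spanning_sets m c d" for M
  proof -
    have "map_prod h id (map_prod h' id u) = u" if "u \<in> M" for u
      using that \<open>M \<in> _\<close> inv(2)[of "fst u"] by (auto simp: spanning_sets_def prod_eq_iff)
    then show ?thesis by (simp add: image_image)
  qed
  then show "\<forall>M\<in>spanning_sets m c d. map_prod h id ` map_prod h' id ` M = M" by blast
  show "(`) (map_prod h id) ` spanning_sets m a b \<subseteq> spanning_sets m c d"
    using spanning_sets_image[OF _ h adj] by blast
  show "(`) (map_prod h' id) ` spanning_sets m c d \<subseteq> spanning_sets m a b"
    using spanning_sets_image[OF _ h' adj'] by blast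
qed

lemma spanning_sets_shift:
  "bij_betw ((`) (map_prod (\<lambda>l. l + d) id)) (spanning_sets m a b) (spanning_sets m (a + d) (b + d))"
proof (rule spanning_sets_bij[where h' = "\<lambda>l. l - d"])
  show h: "(\<lambda>l. l + d) ` {a..b} = {a + d..b + d}"
    by (rule image_add_atLeastAtMost')
  show "(\<lambda>l. l - d) ` {a + d..b + d} = {a..b}"
    unfolding h[symmetric] image_image by simp
qed auto

lemma image_diff_atLeastAtMost_nat:
  fixes a b c :: nat
  assumes "a \<le> b" "b \<le> c"
  shows "(\<lambda>l. c - l) ` {a..b} = {c - b..c - a}"
proof
  show "{c - b..c - a} \<subseteq> (\<lambda>l. c - l) ` {a..b}"
  proof
    fix x assume "x \<in> {c - b..c - a}"
    then have "x = c - (c - x)" "c - x \<in> {a..b}"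
      using assms by auto
    then show "x \<in> (\<lambda>l. c - l) ` {a..b}" by blast
  qed
qed (use assms in auto)

text \<open>The map \<open>l \<mapsto> c - l\<close> is its own inverse on layers up to
  \<open>c\<close>; \<open>b \<le> c\<close> keeps the natural subtraction from truncating.\<close>

lemma spanning_sets_reflect:
  assumes "a \<le> b" "b \<le> c"
  shows "bij_betw ((`) (map_prod (\<lambda>l. c - l) id)) (spanning_sets m a b)
    (spanning_sets m (c - b) (c - a))"
proof (rule spanning_sets_bij[where h' = "\<lambda>l. c - l"])
  show "(\<lambda>l. c - l) ` {c - b..c - a} = {a..b}"
    using assms image_diff_atLeastAtMost_nat[of "c - b" "c - a" c] by simp
qed (use assms image_diff_atLeastAtMost_nat in auto)

section \<open>Sorting connected sets by the layers they meet\<close>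

text \<open>Here \<open>k\<close> is the number of layers met and \<open>d\<close> the number of
  layers before the first of them. There are \<open>n - k + 1\<close> offsets \<open>d\<close> for
  each \<open>k\<close>.\<close>

lemma connected_sets_KP_spanning:
  "connected_sets (KP m n) = (\<Union>(k, d)\<in>(SIGMA k:{1..n}. {0..n - k}). spanning_sets m (1 + d) (k + d))"
proof (intro equalityI subsetI)
  fix M assume "M \<in> connected_sets (KP m n)"
  then have M: "M \<subseteq> {1..n} \<times> {1..m}" "linked grid_edges M"
    by (auto simp: connected_sets_KP)
  have fin: "finite (fst ` M)" and ne: "fst ` M \<noteq> {}" and sub: "fst ` M \<subseteq> {1..n}"
    using M finite_subset[OF M(1)] by (auto simp: linked_def)
  define a b where "a = Min (fst ` M)" and "b = Max (fst ` M)"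
  have ab: "a \<in> fst ` M" "b \<in> fst ` M" "fst ` M \<subseteq> {a..b}"
    unfolding a_def b_def
    using fin ne by (simp_all add: subset_iff del: image_iff split_paired_All)
  \<comment> \<open>Connectedness leaves no gap between the first and the last layer met.\<close>
  have "fst ` M = {a..b}"
    using ab grid_linked_layers_interval[OF M(2) ab(1,2)] by auto
  moreover have "M \<subseteq> {a..b} \<times> {1..m}"
    using M(1) ab(3) by fastforce
  ultimately have "M \<in> spanning_sets m a b"
    using M(2) by (simp add: spanning_sets_def)
  moreover have "1 \<le> a" "a \<le> b" "b \<le> n"
    using ab sub by auto
  ultimately have "M \<in> spanning_sets m (1 + (a - 1)) ((b - a + 1) + (a - 1))"
    "(b - a + 1, a - 1) \<in> (SIGMA k:{1..n}. {0..n - k})"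
    by auto
  then show "M \<in> (\<Union>(k, d)\<in>(SIGMA k:{1..n}. {0..n - k}). spanning_sets m (1 + d) (k + d))"
    by blast
next
  fix M assume "M \<in> (\<Union>(k, d)\<in>(SIGMA k:{1..n}. {0..n - k}). spanning_sets m (1 + d) (k + d))"
  then show "M \<in> connected_sets (KP m n)"
    by (fastforce simp: connected_sets_KP spanning_sets_def)
qed

text \<open>The weight \<open>w\<close> serves two counts at once: constant \<open>1\<close> gives
  the number of connected sets, the identity gives the sum of their orders.\<close>

lemma sum_connected_sets_KP:
  fixes w :: "nat \<Rightarrow> real"
  shows "(\<Sum>M\<in>connected_sets (KP m n). w (card M)) =
    (\<Sum>k=1..n. (real n - real k + 1) * (\<Sum>M\<in>spanning_sets m 1 k. w (card M)))"
proof -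
  let ?T = "\<lambda>(k, d). spanning_sets m (1 + d) (k + d)"
  let ?I = "SIGMA k:{1..n}. {0..n - k}"
  have "?T x \<inter> ?T y = {}" if "x \<in> ?I" "y \<in> ?I" "x \<noteq> y" for x y
  proof (rule ccontr)
    obtain k d k' d' where xy: "x = (k, d)" "y = (k', d')" by (metis surj_pair)
    assume "?T x \<inter> ?T y \<noteq> {}"
    then have "{1 + d..k + d} = {1 + d'..k' + d'}"
      by (auto simp: xy spanning_sets_def)
    \<comment> \<open>Equal intervals have equal endpoints only if they are nonempty.\<close>
    moreover have "k \<ge> 1" "k' \<ge> 1"
      using that xy by auto
    ultimately show False
      using that(3) by (simp add: xy)
  qed
  then have "(\<Sum>M\<in>connected_sets (KP m n). w (card M)) = (\<Sum>x\<in>?I. \<Sum>M\<in>?T x. w (card M))"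
    unfolding connected_sets_KP_spanning
    by (intro sum.UNION_disjoint) (auto simp: finite_spanning_sets)
  also have "\<dots> = (\<Sum>x\<in>?I. \<Sum>M\<in>spanning_sets m 1 (fst x). w (card M))"
  proof (rule sum.cong[OF refl])
    fix x assume "x \<in> ?I"
    obtain k d where x: "x = (k, d)" by (metis surj_pair)
    \<comment> \<open>Translation is injective, so it preserves the order of a set and hence its
      weight.\<close>
    have "inj (map_prod (\<lambda>l. l + d) (id :: nat \<Rightarrow> nat))"
      by (auto simp: inj_def)
    then have "card (map_prod (\<lambda>l. l + d) id ` M) = card M" for M :: "(nat \<times> nat) set"
      by (intro card_image) (auto intro: inj_on_subset)
    then show "(\<Sum>M\<in>?T x. w (card M)) = (\<Sum>M\<in>spanning_sets m 1 (fst x). w (card M))"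
      using sum.reindex_bij_betw[OF spanning_sets_shift[of d m 1 k], of "\<lambda>M. w (card M)"]
      by (simp add: x)
  qed
  also have "\<dots> = (\<Sum>k\<in>{1..n}. \<Sum>d\<in>{0..n - k}. \<Sum>M\<in>spanning_sets m 1 k. w (card M))"
    by (subst sum.Sigma) (auto simp: case_prod_beta)
  also have "\<dots> = (\<Sum>k=1..n. (real n - real k + 1) * (\<Sum>M\<in>spanning_sets m 1 k. w (card M)))"
    by (rule sum.cong) (auto simp: of_nat_diff)
  finally show ?thesis .
qed

section \<open>Cutting at a layer\<close>

text \<open>Both parts keep layer \<open>s\<close>, so they overlap in exactly
  \<open>{s} \<times> J\<close>; taking unions inverts the cut.\<close>

lemma card_spanning_sets_fixed_layer:
  assumes s: "s \<in> {1..k}" and J: "J \<noteq> {}" "J \<subseteq> {1..m}"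
  shows "card {M \<in> spanning_sets m 1 k. M \<inter> layer m s = {s} \<times> J} =
    num_prescribed_end m s J * num_prescribed_end m (k + 1 - s) J"
proof -
  let ?S = "\<lambda>a b. {M \<in> spanning_sets m a b. M \<inter> layer m s = {s} \<times> J}"
  let ?lo = "\<lambda>M. M \<inter> {1..s} \<times> {1..m}"
  let ?hi = "\<lambda>M. M \<inter> {s..k} \<times> {1..m}"
  \<comment> \<open>One claim for both parts, applied below to the intervals \<open>{1..s}\<close>
    and \<open>{s..k}\<close>.\<close>
  have part: "M \<inter> {a..b} \<times> {1..m} \<in> ?S a b"
    if M: "M \<in> ?S 1 k" and ab: "1 \<le> a" "b \<le> k" "a \<le> s" "s \<le> b" "a = 1 \<or> a = s" "b = k \<or> b = s"
    for M a b
  proof -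
    let ?A = "M \<inter> {a..b} \<times> {1..m}"
    have sub: "M \<subseteq> {1..k} \<times> {1..m}" and fst: "fst ` M = {1..k}"
      and lay: "M \<inter> layer m s = {s} \<times> J"
      using M by (simp_all add: spanning_sets_def)
    have Js: "u \<in> {s} \<times> J" if "u \<in> M" "fst u = s" for u
    proof -
      have "u \<in> layer m s"
        using subsetD[OF sub that(1)] that(2) by (auto simp: layer_def)
      then show ?thesis using that(1) lay by blast
    qed
    have "linked grid_edges ?A"
    proof (rule linked_cut_clique[where C = "{s} \<times> J" and M = M])
      show "linked grid_edges M" using M by (simp add: spanning_sets_def)
      show "{s} \<times> J \<subseteq> ?A"
      proof -
        have "{s} \<times> J \<subseteq> M" using lay by blast
        moreover have "{s} \<times> J \<subseteq> {a..b} \<times> {1..m}"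
          by (rule Sigma_mono) (use ab J in simp_all)
        ultimately show ?thesis by blast
      qed
      show "u \<in> {s} \<times> J" if "u \<in> ?A" "v \<in> M - ?A" "(u, v) \<in> grid_edges" for u v
      proof (rule Js)
        show "u \<in> M" using that by simp
        have "fst u \<in> {a..b}" "fst v \<in> {1..k}" "fst v \<notin> {a..b}"
          using that sub by (auto simp: mem_Times_iff)
        moreover have "\<bar>int (fst u) - int (fst v)\<bar> \<le> 1"
          using that(3) by (auto simp: grid_edges_def)
        \<comment> \<open>An edge leaves \<open>{a..b}\<close> only at an end of the interval.
          Beyond the ends \<open>1\<close> and \<open>k\<close> there is no vertex of
          \<open>M\<close>, so the crossing is at \<open>s\<close>.\<close>
        ultimately show "fst u = s" using ab by auto
      qed
      show "(u, v) \<in> grid_edges" if "u \<in> {s} \<times> J" "v \<in> {s} \<times> J" "u \<noteq> v" for u v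
        using that by (auto simp: grid_edges_def)
    qed (use J sym_grid_edges in simp_all)
    moreover have "fst ` ?A = {a..b}"
    proof
      show "{a..b} \<subseteq> fst ` ?A"
      proof
        fix l assume l: "l \<in> {a..b}"
        then have "l \<in> fst ` M" using fst ab by auto
        then show "l \<in> fst ` ?A" using l sub by force
      qed
    qed auto
    moreover have "layer m s \<subseteq> {a..b} \<times> {1..m}"
      using ab by (auto simp: layer_def)
    then have "?A \<inter> layer m s = {s} \<times> J"
      using lay by blast
    ultimately show ?thesis by (simp add: spanning_sets_def)
  qed
  have join: "A \<union> B \<in> ?S 1 k \<and> ?lo (A \<union> B) = A \<and> ?hi (A \<union> B) = B"
    if A: "A \<in> ?S 1 s" and B: "B \<in> ?S s k" for A B
  proof -
    have subs: "A \<subseteq> {1..s} \<times> {1..m}" "B \<subseteq> {s..k} \<times> {1..m}"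
      and lay: "A \<inter> layer m s = {s} \<times> J" "B \<inter> layer m s = {s} \<times> J"
      using A B by (simp_all add: spanning_sets_def)
    have "{s} \<times> J \<subseteq> A \<inter> B" using lay by blast
    then have "A \<inter> B \<noteq> {}" using J by blast
    then have "linked grid_edges (A \<union> B)"
      using A B by (intro linked_Un) (simp_all add: spanning_sets_def)
    moreover have "{1..s} \<union> {s..k} = {1..k}"
      using s by auto
    then have "fst ` (A \<union> B) = {1..k}"
      using A B by (simp add: spanning_sets_def image_Un)
    moreover have "A \<union> B \<subseteq> {1..k} \<times> {1..m}"
      using subs s by fastforce
    moreover have "(A \<union> B) \<inter> layer m s = {s} \<times> J"
      using lay by blast
    \<comment> \<open>Each part reaches into the other's range only in layer \<open>s\<close>, where
      the two agree; cutting the union therefore returns them.\<close>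
    moreover have "?lo B \<subseteq> layer m s" "?hi A \<subseteq> layer m s"
      using subs by (auto simp: layer_def)
    then have "?lo (A \<union> B) = A" "?hi (A \<union> B) = B"
      using subs lay by blast+
    ultimately show ?thesis by (simp add: spanning_sets_def)
  qed
  have "bij_betw (\<lambda>M. (?lo M, ?hi M)) (?S 1 k) (?S 1 s \<times> ?S s k)"
  proof (rule bij_betw_byWitness[where f' = "\<lambda>(A, B). A \<union> B"])
    show "\<forall>M\<in>?S 1 k. (case (?lo M, ?hi M) of (A, B) \<Rightarrow> A \<union> B) = M"
    proof
      fix M assume "M \<in> ?S 1 k"
      then have "M \<subseteq> {1..k} \<times> {1..m}"
        by (simp add: spanning_sets_def)
      moreover have "{1..k} \<times> {1..m} = {1..s} \<times> {1..m} \<union> {s..k} \<times> {1..m}"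
        using s by auto
      ultimately show "(case (?lo M, ?hi M) of (A, B) \<Rightarrow> A \<union> B) = M"
        unfolding prod.case by blast
    qed
    show "(\<lambda>M. (?lo M, ?hi M)) ` ?S 1 k \<subseteq> ?S 1 s \<times> ?S s k"
    proof (intro image_subsetI SigmaI)
      fix M assume "M \<in> ?S 1 k"
      then show "?lo M \<in> ?S 1 s" "?hi M \<in> ?S s k"
        using part[of M 1 s] part[of M s k] s by simp_all
    qed
    show "\<forall>x\<in>?S 1 s \<times> ?S s k. (?lo (case x of (A, B) \<Rightarrow> A \<union> B), ?hi (case x of (A, B) \<Rightarrow> A \<union> B)) = x"
    proof
      fix x assume "x \<in> ?S 1 s \<times> ?S s k"
      then obtain A B where "A \<in> ?S 1 s" "B \<in> ?S s k" "x = (A, B)"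
        by (rule SigmaE)
      then show "(?lo (case x of (A, B) \<Rightarrow> A \<union> B), ?hi (case x of (A, B) \<Rightarrow> A \<union> B)) = x"
        using join[of A B] by (simp only: prod.case)
    qed
    show "(\<lambda>(A, B). A \<union> B) ` (?S 1 s \<times> ?S s k) \<subseteq> ?S 1 k"
    proof
      fix M assume "M \<in> (\<lambda>(A, B). A \<union> B) ` (?S 1 s \<times> ?S s k)"
      then obtain x where x: "x \<in> ?S 1 s \<times> ?S s k" "M = (\<lambda>(A, B). A \<union> B) x"
        by (rule imageE)
      from x(1) obtain A B where "A \<in> ?S 1 s" "B \<in> ?S s k" "x = (A, B)"
        by (rule SigmaE)
      then show "M \<in> ?S 1 k"
        using join[of A B] x(2) by (simp only: prod.case)
    qed
  qed
  then have "card (?S 1 k) = card (?S 1 s) * card (?S s k)"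
    by (simp add: bij_betw_same_card card_cartesian_product)
  moreover have "card (?S 1 s) = num_prescribed_end m s J"
    using num_prescribed_end_eq[OF J] s by simp
  moreover have "card (?S s k) = num_prescribed_end m (k + 1 - s) J"
  proof -
    \<comment> \<open>Reflection in \<open>k + 1\<close> sends the layers \<open>{s..k}\<close> to
      \<open>{1..k + 1 - s}\<close> and makes layer \<open>s\<close> the last one, as
      \<open>num_prescribed_end\<close> requires.\<close>
    let ?r = "map_prod (\<lambda>l. k + 1 - l) (id :: nat \<Rightarrow> nat)"
    let ?S' = "{M \<in> spanning_sets m 1 (k + 1 - s). M \<inter> layer m (k + 1 - s) = {k + 1 - s} \<times> J}"
    have bij: "bij_betw ((`) ?r) (spanning_sets m s k) (spanning_sets m 1 (k + 1 - s))"
      using spanning_sets_reflect[of s k "k + 1" m] s by simp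
    have eq: "?r ` M \<inter> layer m (k + 1 - s) = {k + 1 - s} \<times> J \<longleftrightarrow> M \<inter> layer m s = {s} \<times> J"
      if "M \<in> spanning_sets m s k" for M
    proof -
      have sub: "M \<subseteq> {s..k} \<times> {1..m}"
        using that by (simp add: spanning_sets_def)
      have "(k + 1 - s, j) \<in> ?r ` M \<longleftrightarrow> (s, j) \<in> M" for j
      proof
        assume "(k + 1 - s, j) \<in> ?r ` M"
        then obtain u where u: "(k + 1 - s, j) = ?r u" "u \<in> M"
          by (rule imageE)
        \<comment> \<open>Since \<open>M\<close> lies in layers \<open>s\<close> to
          \<open>k\<close>, no subtraction truncates and the layer of \<open>u\<close> can be
          recovered.\<close>
        then have "u = (s, j)"
          using subsetD[OF sub u(2)] u(1) s by (cases u) auto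
        then show "(s, j) \<in> M" using u(2) by simp
      next
        assume "(s, j) \<in> M"
        then have "?r (s, j) \<in> ?r ` M" by (rule imageI)
        then show "(k + 1 - s, j) \<in> ?r ` M" by simp
      qed
      then have "(\<forall>j. (k + 1 - s, j) \<in> ?r ` M \<and> j \<in> {1..m} \<longleftrightarrow> j \<in> J) \<longleftrightarrow>
          (\<forall>j. (s, j) \<in> M \<and> j \<in> {1..m} \<longleftrightarrow> j \<in> J)"
        by simp
      moreover have "X \<inter> layer m l = {l} \<times> J \<longleftrightarrow> (\<forall>j. (l, j) \<in> X \<and> j \<in> {1..m} \<longleftrightarrow> j \<in> J)" for X l
        unfolding layer_def set_eq_iff by auto
      ultimately show ?thesis by simp
    qed
    have "bij_betw ((`) ?r) (?S s k) ?S'"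
      using bij eq by (rule bij_betw_Collect)
    then have "card (?S s k) = card ?S'"
      by (rule bij_betw_same_card)
    moreover have "k + 1 - s \<ge> 1"
      using s by auto
    ultimately show ?thesis
      by (simp only: num_prescribed_end_eq[OF J])
  qed
  ultimately show ?thesis by simp
qed

section \<open>Counting the missing vertices\<close>

lemma sum_by_card:
  fixes h :: "nat \<Rightarrow> real"
  shows "(\<Sum>J\<in>{J. J \<subseteq> {1..m} \<and> J \<noteq> {}}. h (card J)) = (\<Sum>i=1..m. real (m choose i) * h i)"
proof -
  let ?P = "{J. J \<subseteq> {1..m} \<and> J \<noteq> {}}"
  have fin: "finite ?P"
    by (rule finite_subset[of _ "Pow {1..m}"]) auto
  have "card J \<in> {1..m}" if "J \<in> ?P" for J
    using that card_mono[of "{1..m}" J] finite_subset[of J "{1..m}"]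
    by (auto simp: Suc_le_eq card_gt_0_iff)
  then have "(\<Sum>J\<in>?P. h (card J)) = (\<Sum>i=1..m. \<Sum>J\<in>{J \<in> ?P. card J = i}. h (card J))"
    using fin by (intro sum.group[symmetric]) blast+
  also have "\<dots> = (\<Sum>i=1..m. real (m choose i) * h i)"
  proof (rule sum.cong[OF refl])
    fix i assume "i \<in> {1..m}"
    then have "{J \<in> ?P. card J = i} = {J. J \<subseteq> {1..m} \<and> card J = i}"
      by auto
    then show "(\<Sum>J\<in>{J \<in> ?P. card J = i}. h (card J)) = real (m choose i) * h i"
      using n_subsets[of "{1..m}" i] by simp
  qed
  finally show ?thesis .
qed

text \<open>The sets are grouped by their trace \<open>J\<close> on layer \<open>s\<close>, which is
  nonempty since every layer is met. Each \<open>J\<close> contributes its deficit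
  \<open>m - card J\<close> times the product from the cut.\<close>

lemma sum_missing_in_layer:
  assumes s: "s \<in> {1..k}"
  shows "(\<Sum>M\<in>spanning_sets m 1 k. real m - real (card (M \<inter> layer m s))) =
    (\<Sum>i=1..m-1. real (m choose i) * (real m - real i)
      * real (num_fixed_end i m s) * real (num_fixed_end i m (k + 1 - s)))"
proof -
  let ?T = "spanning_sets m 1 k"
  let ?P = "{J. J \<subseteq> {1..m} \<and> J \<noteq> {}}"
  let ?g = "\<lambda>M. snd ` (M \<inter> layer m s)"
  let ?h = "\<lambda>i. (real m - real i) * real (num_fixed_end i m s) * real (num_fixed_end i m (k + 1 - s))"
  have fin: "finite ?P"
    by (rule finite_subset[of _ "Pow {1..m}"]) auto
  have g: "?g M = J \<longleftrightarrow> M \<inter> layer m s = {s} \<times> J" for M J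
  proof -
    have "M \<inter> layer m s = {s} \<times> ?g M"
      by (force simp: layer_def)
    then show ?thesis by (metis snd_image_times insert_not_empty)
  qed
  have "?g ` ?T \<subseteq> ?P"
  proof
    fix J assume "J \<in> ?g ` ?T"
    then obtain M where M: "M \<in> ?T" "J = ?g M" by blast
    then have "M \<inter> layer m s \<noteq> {}"
      using fst_image_eq_iff_layers[of M 1 k m] s by (simp add: spanning_sets_def)
    then show "J \<in> ?P" using M by (auto simp: layer_def)
  qed
  then have "(\<Sum>M\<in>?T. real m - real (card (M \<inter> layer m s))) =
      (\<Sum>J\<in>?P. \<Sum>M\<in>{M \<in> ?T. ?g M = J}. real m - real (card (M \<inter> layer m s)))"
    using fin by (intro sum.group[symmetric]) (auto simp: finite_spanning_sets)
  also have "\<dots> = (\<Sum>J\<in>?P. ?h (card J))"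
  proof (rule sum.cong[OF refl])
    fix J assume J: "J \<in> ?P"
    have "(\<Sum>M\<in>{M \<in> ?T. ?g M = J}. real m - real (card (M \<inter> layer m s))) =
        (\<Sum>M\<in>{M \<in> ?T. M \<inter> layer m s = {s} \<times> J}. real m - real (card J))"
      by (rule sum.cong) (auto simp: g card_cartesian_product_singleton)
    then show "(\<Sum>M\<in>{M \<in> ?T. ?g M = J}. real m - real (card (M \<inter> layer m s))) = ?h (card J)"
      using J card_spanning_sets_fixed_layer[OF s, of J m] by (simp add: num_fixed_end_eq)
  qed
  also have "\<dots> = (\<Sum>i=1..m. real (m choose i) * ?h i)"
    by (rule sum_by_card)
  \<comment> \<open>The term \<open>i = m\<close> vanishes: a full layer misses nothing.\<close>
  also have "\<dots> = (\<Sum>i=1..m-1. real (m choose i) * ?h i)"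
    by (cases m) simp_all
  finally show ?thesis by (simp add: mult.assoc)
qed

text \<open>The layers partition \<open>M\<close>; each contributes \<open>m\<close> minus its
  deficit.\<close>

lemma card_spanning_set:
  assumes "M \<in> spanning_sets m 1 k"
  shows "real (card M) = real m * real k - (\<Sum>s=1..k. real m - real (card (M \<inter> layer m s)))"
proof -
  have sub: "M \<subseteq> {1..k} \<times> {1..m}"
    using assms by (simp add: spanning_sets_def)
  then have "M = (\<Union>s\<in>{1..k}. M \<inter> layer m s)"
    by (auto simp: layer_def)
  moreover have "card (\<Union>s\<in>{1..k}. M \<inter> layer m s) = (\<Sum>s=1..k. card (M \<inter> layer m s))"
    by (rule card_UN_disjoint) (auto simp: layer_def)
  ultimately have "card M = (\<Sum>s=1..k. card (M \<inter> layer m s))" by simp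
  then show ?thesis by (simp add: sum_subtractf)
qed

lemma sum_card_spanning_sets:
  "(\<Sum>M\<in>spanning_sets m 1 k. real (card M)) =
    real m * real k * real (num_spanning_layers m k)
    - (\<Sum>i=1..m-1. \<Sum>s=1..k. real (m choose i) * (real m - real i)
        * real (num_fixed_end i m s) * real (num_fixed_end i m (k + 1 - s)))"
proof -
  let ?T = "spanning_sets m 1 k"
  have "(\<Sum>M\<in>?T. real (card M)) =
      real m * real k * real (card ?T)
      - (\<Sum>M\<in>?T. \<Sum>s=1..k. real m - real (card (M \<inter> layer m s)))"
    by (simp add: card_spanning_set sum_subtractf)
  \<comment> \<open>With \<open>s\<close> outermost, the inner sum concerns one fixed layer and
    \<open>sum_missing_in_layer\<close> applies.\<close>
  also have "(\<Sum>M\<in>?T. \<Sum>s=1..k. real m - real (card (M \<inter> layer m s))) =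
      (\<Sum>s=1..k. \<Sum>M\<in>?T. real m - real (card (M \<inter> layer m s)))"
    by (rule sum.swap)
  also have "\<dots> = (\<Sum>s=1..k. \<Sum>i=1..m-1. real (m choose i) * (real m - real i)
        * real (num_fixed_end i m s) * real (num_fixed_end i m (k + 1 - s)))"
    by (rule sum.cong[OF refl]) (rule sum_missing_in_layer)
  also have "\<dots> = (\<Sum>i=1..m-1. \<Sum>s=1..k. real (m choose i) * (real m - real i)
        * real (num_fixed_end i m s) * real (num_fixed_end i m (k + 1 - s)))"
    by (rule sum.swap)
  finally show ?thesis by (simp only: num_spanning_layers_eq)
qed

theorem theorem3p7:
  fixes m n :: nat
  assumes "m \<ge> 1" and "n \<ge> 1"
  shows "connected_set_density (KP m n) =
    (\<Sum>k=1..n. (real n - real k + 1) *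
        (real m * real k * real (num_spanning_layers m k)
         - (\<Sum>i=1..m-1. \<Sum>s=1..k. real (m choose i) * (real m - real i)
               * real (num_fixed_end i m s) * real (num_fixed_end i m (k + 1 - s)))))
    / (real m * real n * (\<Sum>k=1..n. (real n - real k + 1) * real (num_spanning_layers m k)))"
proof -
  \<comment> \<open>Both counts come from the same decomposition, with weight \<open>1\<close> here
    and weight \<open>card M\<close> next; the remaining factor of the denominator is the number of
    vertices.\<close>
  have "real (num_connected_sets (KP m n)) =
      (\<Sum>k=1..n. (real n - real k + 1) * real (num_spanning_layers m k))"
    using sum_connected_sets_KP[where w = "\<lambda>_. 1"]
    by (simp add: num_connected_sets_def num_spanning_layers_eq)
  moreover have "real (total_order_connected_sets (KP m n)) =
      (\<Sum>k=1..n. (real n - real k + 1) * (\<Sum>M\<in>spanning_sets m 1 k. real (card M)))"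
    using sum_connected_sets_KP[where w = real]
    by (simp add: total_order_connected_sets_def)
  ultimately show ?thesis
    unfolding connected_set_density_def avg_connected_set_def card_verts_KP sum_card_spanning_sets
    by (simp add: mult.commute)
qed

end
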